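(* Let $\mathscr D(\mu)=1-\mu^2$. Suppose that for every $N$ the nodes $\mu_n=\mu_n^N$ and points $\mu_{n+1/2}=\mu_{n+1/2}^N$ are given and that, as $N\to\infty$: (1) $-1=\mu_{1/2}<\mu_1<\mu_{1+1/2}<\cdots<\mu_{N-1/2}<\mu_N<\mu_{N+1/2}=1$ for every $N$; (2) $\widetilde M_N=O(N^{-1})$; (3) $D_N^*=O(N^{-q})$ with $q\ge 2$; (4) $D_N=O(N^{-r})$ with $r\ge 2$; (5) $1/m_N^*=O(N^{s})$ with $1\le s\le 4m-2$, where $m=\min\{q,r\}$; (6) $\beta_N(\mathscr D)=O(N^{-t})$ with $t\ge 2$; (7) $\beta_N^*(\mathscr D)=O(N^{-u})$ with $u\ge 2$; (8) $X_N=O(N^{-v})$ with $v\ge 2$. Then the type II scheme $\Delta_{{\rm FP},N}$ converges with order $2$ for every $f\in C^5([-1,1])$, i.e. $\max_{1\le n\le N}|\Delta_{\rm FP}f(\mu_n)-\Delta_{{\rm FP},N}f(\mu_n)|=O(N^{-2})$. The same conclusion holds if, instead of (1)--(8), one assumes either (i) $D_N=D_N^*=0$ for all $N$, and (1), (2) and (8) hold; or (ii) $d_1=\cdots=d_{N-1}$ for all $N$, and (1)--(5) and (8) hold; or (iii) $\Lambda_N=0$ for all $N$, and (1)--(6) hold. Furthermore, if $s\le r$, where $r$ and $s$ are the exponents in (4) and (5), then hypothesis (7) can be omitted, since it is automatically fulfilled as a consequence of the others.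
   Context: For each natural $N$ one is given nodes $\mu_1,\dots,\mu_N$ and points $\mu_{1/2},\dots,\mu_{N+1/2}$ in $[-1,1]$ (dependence on $N$ suppressed). All $O(\cdot)$ are as $N\to\infty$; quantities given by maxima over empty index sets (small $N$) are irrelevant. Definitions: - $\widetilde M_N=\max\{\mu_1+1,\ \max_{1\le n\le N-1}(\mu_{n+1}-\mu_n),\ 1-\mu_N\}$. - $d_n=\frac{\mu_n+\mu_{n+1}}2-\mu_{n+1/2}$ for $1\le n\le N-1$; $D_N=\max_{1\le n\le N-1}|d_n|$. - $d_n^*=\frac{\mu_{n-1/2}+\mu_{n+1/2}}2-\mu_n$ for $1\le n\le N$; $D_N^*=\max_{1\le n\le N}|d_n^*|$. - $m_N^*=\min_{1\le n\le N}(\mu_{n+1/2}-\mu_{n-1/2})$. - $\alpha_{1/2}=0$ and $\alpha_{n+1/2}=\alpha_{n-1/2}-2\mu_n(\mu_{n+1/2}-\mu_{n-1/2})$ for $n=1,\dots,N$. - $\lambda_n=\mathscr D(\mu_{n+1/2})-\alpha_{n+1/2}$ for $n=0,\dots,N$; $\Lambda_N=\max_{0\le n\le N}|\lambda_n|$. - $\beta_N(\mathscr D)=\max_{2\le n\le N-1}\left|\frac{(d_{n-1}-d_n)\,\mathscr D(\mu_{n+1/2})}{\mu_{n+1/2}-\mu_{n-1/2}}\right|$. - $\beta_N^*(\mathscr D)=\max_{2\le n\le N-1}\left|\frac{(d_{n-1}-d_n)\,\lambda_n}{\mu_{n+1/2}-\mu_{n-1/2}}\right|$. - $X_N=\left|\frac{\alpha_{N+1/2}}{1-\mu_{N-1/2}}\right|$.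 The operator is $\Delta_{\rm FP}f(\mu)=(\mathscr D(\mu)f'(\mu))'=((1-\mu^2)f'(\mu))'$ on $[-1,1]$. The type II scheme is $$\Delta_{{\rm FP},N}f(\mu_1)=\frac{\alpha_{1+1/2}\frac{f(\mu_2)-f(\mu_1)}{\mu_2-\mu_1}}{\mu_{1+1/2}+1},$$ $$\Delta_{{\rm FP},N}f(\mu_n)=\frac{\alpha_{n+1/2}\frac{f(\mu_{n+1})-f(\mu_n)}{\mu_{n+1}-\mu_n}-\alpha_{n-1/2}\frac{f(\mu_n)-f(\mu_{n-1})}{\mu_n-\mu_{n-1}}}{\mu_{n+1/2}-\mu_{n-1/2}},\quad n=2,\dots,N-1,$$ $$\Delta_{{\rm FP},N}f(\mu_N)=\frac{-\alpha_{N-1/2}\frac{f(\mu_N)-f(\mu_{N-1})}{\mu_N-\mu_{N-1}}}{1-\mu_{N-1/2}}.$$ *)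

theory Defs
  imports "HOL-Analysis.Analysis" "HOL-Library.Landau_Symbols"
begin

text \<open>
  A mesh family is a pair \<open>mu nu :: nat \<Rightarrow> nat \<Rightarrow> real\<close>: \<open>mu N n\<close> is the node
  $\mu_n^N$ (relevant for $1 \le n \le N$) and \<open>nu N n\<close> is the point $\mu_{n+1/2}^N$
  (relevant for $0 \le n \le N$), so that $\mu_{n-1/2}^N$ is \<open>nu N (n - 1)\<close> for $n \ge 1$.
  The natural numbers $N$ indexing the meshes start at 1; the values at $N = 0$ play no role.
\<close>

definition max_abs :: "nat set \<Rightarrow> (nat \<Rightarrow> real) \<Rightarrow> real" where
  \<comment> \<open>The value 0 for an empty index set matters only for small \<open>N\<close>: it keeps a
      condition such as $D_N = 0$ for all $N$ meaningful at $N = 1$.\<close>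
  "max_abs I a = (if I = {} then 0 else (MAX n\<in>I. \<bar>a n\<bar>))"

definition interlaced :: "(nat \<Rightarrow> nat \<Rightarrow> real) \<Rightarrow> (nat \<Rightarrow> nat \<Rightarrow> real) \<Rightarrow> bool" where
  "interlaced mu nu \<longleftrightarrow>
     (\<forall>N\<ge>1. nu N 0 = -1 \<and> nu N N = 1 \<and>
        (\<forall>n\<in>{1..N}. nu N (n - 1) < mu N n \<and> mu N n < nu N n))"

definition Mtilde :: "(nat \<Rightarrow> nat \<Rightarrow> real) \<Rightarrow> nat \<Rightarrow> real" where
  "Mtilde mu N =
     Max ({mu N 1 + 1} \<union> (\<lambda>n. mu N (n + 1) - mu N n) ` {1..<N} \<union> {1 - mu N N})"

definition d :: "(nat \<Rightarrow> nat \<Rightarrow> real) \<Rightarrow> (nat \<Rightarrow> nat \<Rightarrow> real) \<Rightarrow> nat \<Rightarrow> nat \<Rightarrow> real" where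
  "d mu nu N n = (mu N n + mu N (n + 1)) / 2 - nu N n"

definition D :: "(nat \<Rightarrow> nat \<Rightarrow> real) \<Rightarrow> (nat \<Rightarrow> nat \<Rightarrow> real) \<Rightarrow> nat \<Rightarrow> real" where
  "D mu nu N = max_abs {1..<N} (d mu nu N)"

definition d_star :: "(nat \<Rightarrow> nat \<Rightarrow> real) \<Rightarrow> (nat \<Rightarrow> nat \<Rightarrow> real) \<Rightarrow> nat \<Rightarrow> nat \<Rightarrow> real" where
  "d_star mu nu N n = (nu N (n - 1) + nu N n) / 2 - mu N n"

definition D_star :: "(nat \<Rightarrow> nat \<Rightarrow> real) \<Rightarrow> (nat \<Rightarrow> nat \<Rightarrow> real) \<Rightarrow> nat \<Rightarrow> real" where
  "D_star mu nu N = max_abs {1..N} (d_star mu nu N)"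

definition m_star :: "(nat \<Rightarrow> nat \<Rightarrow> real) \<Rightarrow> nat \<Rightarrow> real" where
  "m_star nu N = (MIN n\<in>{1..N}. nu N n - nu N (n - 1))"

text \<open>\<open>alpha mu nu N n\<close>, \<open>lam mu nu N n\<close> are $\alpha_{n+1/2}$ and $\lambda_n$.\<close>

primrec alpha :: "(nat \<Rightarrow> nat \<Rightarrow> real) \<Rightarrow> (nat \<Rightarrow> nat \<Rightarrow> real) \<Rightarrow> nat \<Rightarrow> nat \<Rightarrow> real" where
  "alpha mu nu N 0 = 0"
| "alpha mu nu N (Suc n) =
     alpha mu nu N n - 2 * mu N (Suc n) * (nu N (Suc n) - nu N n)"

definition diffusivity :: "real \<Rightarrow> real" where
  "diffusivity x = 1 - x\<^sup>2"

definition lam :: "(nat \<Rightarrow> nat \<Rightarrow> real) \<Rightarrow> (nat \<Rightarrow> nat \<Rightarrow> real) \<Rightarrow> nat \<Rightarrow> nat \<Rightarrow> real" where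
  "lam mu nu N n = diffusivity (nu N n) - alpha mu nu N n"

definition Lam :: "(nat \<Rightarrow> nat \<Rightarrow> real) \<Rightarrow> (nat \<Rightarrow> nat \<Rightarrow> real) \<Rightarrow> nat \<Rightarrow> real" where
  "Lam mu nu N = max_abs {0..N} (lam mu nu N)"

definition beta :: "(nat \<Rightarrow> nat \<Rightarrow> real) \<Rightarrow> (nat \<Rightarrow> nat \<Rightarrow> real) \<Rightarrow> nat \<Rightarrow> real" where
  "beta mu nu N = max_abs {2..<N}
     (\<lambda>n. (d mu nu N (n - 1) - d mu nu N n) * diffusivity (nu N n) / (nu N n - nu N (n - 1)))"

definition beta_star :: "(nat \<Rightarrow> nat \<Rightarrow> real) \<Rightarrow> (nat \<Rightarrow> nat \<Rightarrow> real) \<Rightarrow> nat \<Rightarrow> real" where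
  "beta_star mu nu N = max_abs {2..<N}
     (\<lambda>n. (d mu nu N (n - 1) - d mu nu N n) * lam mu nu N n / (nu N n - nu N (n - 1)))"

definition X :: "(nat \<Rightarrow> nat \<Rightarrow> real) \<Rightarrow> (nat \<Rightarrow> nat \<Rightarrow> real) \<Rightarrow> nat \<Rightarrow> real" where
  "X mu nu N = \<bar>alpha mu nu N N / (1 - nu N (N - 1))\<bar>"

text \<open>
  Derivatives on $[-1,1]$ are taken within that interval, hence one-sided at the end points.
\<close>

definition Ck_on :: "nat \<Rightarrow> real set \<Rightarrow> (real \<Rightarrow> real) \<Rightarrow> bool" where
  "Ck_on k S f \<longleftrightarrow>
     (\<exists>g. g 0 = f \<and>
        (\<forall>i<k. \<forall>x\<in>S. (g i has_real_derivative g (Suc i) x) (at x within S)) \<and>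
        (\<forall>i\<le>k. continuous_on S (g i)))"

definition FP :: "(real \<Rightarrow> real) \<Rightarrow> real \<Rightarrow> real" where
  "FP f x =
     vector_derivative (\<lambda>y. diffusivity y * vector_derivative f (at y within {-1..1}))
       (at x within {-1..1})"

definition diff_quot :: "(nat \<Rightarrow> nat \<Rightarrow> real) \<Rightarrow> (real \<Rightarrow> real) \<Rightarrow> nat \<Rightarrow> nat \<Rightarrow> real" where
  "diff_quot mu f N n = (f (mu N (n + 1)) - f (mu N n)) / (mu N (n + 1) - mu N n)"

text \<open>
  \<open>FP_typeII mu nu f N n\<close> is $\Delta_{{\rm FP},N} f(\mu_n)$. The two boundary formulas
  overlap only for $N = 1$, where the scheme is degenerate.
\<close>

definition FP_typeII ::
    "(nat \<Rightarrow> nat \<Rightarrow> real) \<Rightarrow> (nat \<Rightarrow> nat \<Rightarrow> real) \<Rightarrow> (real \<Rightarrow> real) \<Rightarrow> nat \<Rightarrow> nat \<Rightarrow> real" where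
  "FP_typeII mu nu f N n =
     (if n = 1 then alpha mu nu N 1 * diff_quot mu f N 1 / (nu N 1 + 1)
      else if n = N then
        - alpha mu nu N (N - 1) * diff_quot mu f N (N - 1) / (1 - nu N (N - 1))
      else
        (alpha mu nu N n * diff_quot mu f N n - alpha mu nu N (n - 1) * diff_quot mu f N (n - 1))
          / (nu N n - nu N (n - 1)))"

definition typeII_converges ::
    "real \<Rightarrow> (nat \<Rightarrow> nat \<Rightarrow> real) \<Rightarrow> (nat \<Rightarrow> nat \<Rightarrow> real) \<Rightarrow> (real \<Rightarrow> real) \<Rightarrow> bool" where
  "typeII_converges p mu nu f \<longleftrightarrow>
     (\<lambda>N. max_abs {1..N} (\<lambda>n. FP f (mu N n) - FP_typeII mu nu f N n))
       \<in> O(\<lambda>N. real N powr (- p))"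

end

theory Submission
  imports Defs
begin

text \<open>
  Write $h_n = \mu_{n+1/2} - \mu_{n-1/2}$ and $k_n = \mu_{n+1} - \mu_n$. Three exact identities carry
  the proof: $k_n + k_{n-1} = 2 (h_n + d_n - d_{n-1})$, $k_n - k_{n-1} = 4 d_n^* + 2 (d_n + d_{n-1})$
  and $\lambda_n = \lambda_{n-1} - 2 h_n d_n^*$. The last one gives $|\lambda_n| \le 4 D_N^*$. In the
  Taylor expansion of the scheme about $\mu_n$ the $f'$ terms cancel by the definition of $\alpha$,
  and every division by $h_n$ that does not cancel can be arranged as the factor
  $\alpha_{n+1/2} (k_n + k_{n-1}) / h_n$. By the first identity this factor is
  $2 \alpha_{n+1/2}$ up to an error of at most $2 (\beta_N + \beta_N^*)$.
\<close>

section \<open>Maxima of absolute values over finite index sets\<close>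

lemma max_abs_ge:
  assumes "finite I" "n \<in> I"
  shows "\<bar>a n\<bar> \<le> max_abs I a"
  using assms by (auto simp: max_abs_def)

lemma max_abs_le:
  assumes "finite I" "0 \<le> c" "\<And>n. n \<in> I \<Longrightarrow> \<bar>a n\<bar> \<le> c"
  shows "max_abs I a \<le> c"
  using assms by (auto simp: max_abs_def)

lemma max_abs_nonneg:
  assumes "finite I"
  shows "0 \<le> max_abs I a"
  using assms by (cases "I = {}") (auto simp: max_abs_def Max_ge_iff ex_in_conv)

section \<open>Derivatives and Taylor expansion on [-1,1]\<close>

lemma Ck_on_mono: "Ck_on k S f \<Longrightarrow> j \<le> k \<Longrightarrow> Ck_on j S f"
  unfolding Ck_on_def by (erule exE, rule_tac x = g in exI) auto

text \<open>One-sided derivatives at the end points of a nondegenerate closed interval are unique,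
  so both occurrences of \<open>vector_derivative\<close> in \<open>FP\<close> can be evaluated
  there; the rest is the product rule.\<close>

lemma FP_eq:
  assumes f': "\<And>y. y \<in> {-1..1} \<Longrightarrow> (f has_real_derivative f1 y) (at y within {-1..1})"
    and f'': "(f1 has_real_derivative c) (at x within {-1..1})"
    and x: "x \<in> {-1..1}"
  shows "FP f x = (1 - x\<^sup>2) * c - 2 * x * f1 x"
proof -
  have vd: "vector_derivative f (at y within {-1..1}) = f1 y" if "y \<in> {-1..1}" for y
    by (rule vector_derivative_within_closed_interval)
      (use f'[OF that] that in \<open>auto simp: has_real_derivative_iff_has_vector_derivative\<close>)
  have "((\<lambda>y. diffusivity y * f1 y) has_real_derivative (1 - x\<^sup>2) * c - 2 * x * f1 x)
      (at x within {-1..1})"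
    unfolding diffusivity_def by (auto intro!: derivative_eq_intros f'' simp: algebra_simps)
  \<comment> \<open>The derivative of \<open>f\<close> is known to be \<open>f1\<close> only on
    [-1,1], so the function is replaced within that set; the radius 1 is arbitrary.\<close>
  then have "((\<lambda>y. diffusivity y * vector_derivative f (at y within {-1..1}))
      has_real_derivative (1 - x\<^sup>2) * c - 2 * x * f1 x) (at x within {-1..1})"
    by (rule has_field_derivative_transform_within[where d = 1]) (use x vd in auto)
  then show ?thesis
    unfolding FP_def by (intro vector_derivative_within_closed_interval)
      (use x in \<open>auto simp: has_real_derivative_iff_has_vector_derivative\<close>)
qed

text \<open>The factor \<open>y - x\<close> is pulled out so that dividing by it gives a difference
  quotient at once. By compactness a single \<open>B\<close>, independent of both points, bounds the
  derivatives and the remainder factor \<open>R\<close>.\<close>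

lemma Ck_on_4_expansion:
  assumes "Ck_on 4 {-1..1} f"
  obtains f1 f2 f3 :: "real \<Rightarrow> real" and B :: real where "0 \<le> B"
    "\<And>x. x \<in> {-1..1} \<Longrightarrow> \<bar>f1 x\<bar> \<le> B \<and> \<bar>f2 x\<bar> \<le> B \<and> \<bar>f3 x\<bar> \<le> B"
    "\<And>x. x \<in> {-1..1} \<Longrightarrow> FP f x = (1 - x\<^sup>2) * f2 x - 2 * x * f1 x"
    "\<And>x y. x \<in> {-1..1} \<Longrightarrow> y \<in> {-1..1} \<Longrightarrow> \<exists>R. \<bar>R\<bar> \<le> B \<and>
       f y - f x = (y - x) * (f1 x + (y - x) / 2 * f2 x + (y - x)\<^sup>2 / 6 * f3 x + (y - x)^3 * R)"
proof -
  obtain g where g0: "g 0 = f"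
    and der: "\<And>i x. i < 4 \<Longrightarrow> x \<in> {-1..1} \<Longrightarrow>
        (g i has_real_derivative g (Suc i) x) (at x within {-1..1})"
    and cont: "\<And>i. i \<le> 4 \<Longrightarrow> continuous_on {-1..1} (g i)"
    using assms unfolding Ck_on_def by auto
  have "\<exists>b. \<forall>x\<in>{-1..1}. \<bar>g i x\<bar> \<le> b" if "i \<le> 4" for i
    using compact_imp_bounded[OF compact_continuous_image[OF cont[OF that] compact_Icc]]
    by (auto simp: bounded_iff)
  then obtain b where b: "\<And>i x. i \<le> 4 \<Longrightarrow> x \<in> {-1..1} \<Longrightarrow> \<bar>g i x\<bar> \<le> b i"
    by metis
  define B where "B = (\<Sum>i\<le>4. \<bar>b i\<bar>)"
  have B: "\<bar>g i x\<bar> \<le> B" if "i \<le> 4" "x \<in> {-1..1}" for i x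
  proof -
    have "\<bar>b i\<bar> \<le> B"
      unfolding B_def by (rule member_le_sum) (use that in auto)
    then show ?thesis using b[OF that] by linarith
  qed
  show thesis
  proof (rule that[of B "g 1" "g 2" "g 3"])
    show "0 \<le> B" unfolding B_def by (simp add: sum_nonneg)
    show "\<bar>g 1 x\<bar> \<le> B \<and> \<bar>g 2 x\<bar> \<le> B \<and> \<bar>g 3 x\<bar> \<le> B" if "x \<in> {-1..1}" for x
      using B that by auto
    show "FP f x = (1 - x\<^sup>2) * g 2 x - 2 * x * g 1 x" if "x \<in> {-1..1}" for x
      by (rule FP_eq) (use der[of 0] der[of 1 x] g0 that in \<open>auto simp: numeral_2_eq_2\<close>)
    show "\<exists>R. \<bar>R\<bar> \<le> B \<and>
        f y - f x = (y - x) * (g 1 x + (y - x) / 2 * g 2 x + (y - x)\<^sup>2 / 6 * g 3 x + (y - x)^3 * R)"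
      if x: "x \<in> {-1..1}" and y: "y \<in> {-1..1}" for x y
    proof -
      define T where "T = f y - f x - (y - x) * (g 1 x + (y - x) / 2 * g 2 x + (y - x)\<^sup>2 / 6 * g 3 x)"
      have "norm (g 0 y - (\<Sum>i\<le>3. g i x * (y - x)^i / fact i)) \<le> B * norm (y - x)^(Suc 3) / fact 3"
        by (rule field_Taylor[of "{-1..1}"]) (use der B x y in auto)
      moreover have "g 0 y - (\<Sum>i\<le>3. g i x * (y - x)^i / fact i) = T"
        unfolding T_def g0 by (simp add: eval_nat_numeral fact_numeral g0 field_simps)
      moreover have "\<bar>y - x\<bar>^4 = (y - x)^4"
        by (simp add: power_even_abs)
      ultimately have "\<bar>T\<bar> \<le> B * (y - x)^4 / 6"
        by (simp add: fact_numeral)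
      \<comment> \<open>The factor 1/6 is dropped, since only the order of the remainder
        matters.\<close>
      also have "\<dots> \<le> B * (y - x)^4"
        using B[of 0 x] x by (auto simp: field_simps intro: mult_nonneg_nonneg)
      finally have T: "\<bar>T\<bar> \<le> B * (y - x)^4" .
      show ?thesis
      \<comment> \<open>The remainder factor is \<open>T / (y - x)^4\<close>; at
        \<open>y = x\<close> both sides vanish and 0 serves.\<close>
      proof (cases "y = x")
        case True
        then show ?thesis using B[of 0 x] x by (intro exI[of _ 0]) auto
      next
        case False
        then have pos: "(y - x)^4 > 0" by (simp add: zero_less_power_eq)
        have "\<bar>T / (y - x)^4\<bar> \<le> B"
          using T pos by (simp add: abs_divide divide_le_eq)
        moreover have "f y - f x = (y - x) * (g 1 x + (y - x) / 2 * g 2 x + (y - x)\<^sup>2 / 6 * g 3 x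
            + (y - x)^3 * (T / (y - x)^4))"
        proof -
          have "(y - x) * ((y - x)^3 * (T / (y - x)^4)) = T"
            using False power_add[of "y - x" 1 3] by (simp flip: mult.assoc)
          then show ?thesis unfolding T_def by (simp add: distrib_left)
        qed
        ultimately show ?thesis by blast
      qed
    qed
  qed
qed

section \<open>Local truncation errors as inequalities between real numbers\<close>

text \<open>Here \<open>m\<close> is the node, \<open>p\<close> and \<open>p'\<close> are the steps
  to its right and left, \<open>a\<close> and \<open>a'\<close> the matching values of
  \<open>alpha\<close>, and \<open>p / 2 - dn\<close> is the distance from the node to the half
  point on its right. By the relation between \<open>a'\<close> and \<open>a\<close> the
  \<open>f1\<close> terms cancel. The constant is 59 = 16 + 17 + 26, from the \<open>f2\<close>
  terms, the \<open>f3\<close> terms and the remainders.\<close>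

lemma interior_consistency:
  fixes E B h p p' m a a' dn dn' ds l :: real
  assumes pos: "h > 0" "p > 0" "p' > 0" "0 \<le> B"
    and small: "E \<le> 1" "p\<^sup>2 \<le> E" "p'\<^sup>2 \<le> E" "\<bar>m\<bar> \<le> 1" "\<bar>m + p / 2 - dn\<bar> \<le> 1"
      "0 \<le> p / 2 - dn" "p / 2 - dn \<le> p"
    and defects: "\<bar>dn\<bar> \<le> E" "\<bar>dn'\<bar> \<le> E" "\<bar>ds\<bar> \<le> E" "\<bar>l\<bar> \<le> 4 * E"
      "\<bar>a * ((dn - dn') / h)\<bar> \<le> E"
    and sum: "p + p' = 2 * (h + (dn - dn'))" and diff: "p - p' = 4 * ds + 2 * (dn + dn')"
    and a': "a' = a + 2 * m * h" and a: "a = 1 - (m + p / 2 - dn)\<^sup>2 - l"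
    and f: "\<bar>f2\<bar> \<le> B" "\<bar>f3\<bar> \<le> B" "\<bar>R\<bar> \<le> B" "\<bar>R'\<bar> \<le> B"
  shows "\<bar>((1 - m\<^sup>2) * f2 - 2 * m * f1)
     - (a * (f1 + p / 2 * f2 + p\<^sup>2 / 6 * f3 + p^3 * R)
        - a' * (f1 - p' / 2 * f2 + p'\<^sup>2 / 6 * f3 - p'^3 * R')) / h\<bar> \<le> 59 * B * E"
proof -
  \<comment> \<open>\<open>g\<close> is the quantity that \<open>beta\<close> and
    \<open>beta_star\<close> control. By \<open>sum\<close>, \<open>w\<close> equals
    \<open>a * (p + p') / h\<close>, which turns this quotient by \<open>h\<close> into bounded
    terms.\<close>
  define g where "g = a * ((dn - dn') / h)"
  define w where "w = 2 * a + 2 * g"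
  \<comment> \<open>The error in the coefficient of \<open>f2\<close>, written so that every summand
    is visibly small: 1 + 4 + 8 + 2 + 1 = 16 multiples of \<open>E\<close>. Its form as that
    coefficient is derived below.\<close>
  define A2 where "A2 = g - l - m * (p - p') + 2 * m * dn - (p / 2 - dn)\<^sup>2"
  have E0: "0 \<le> E" using small(2) zero_le_power2[of p] by linarith
  have wh: "w * h = a * (p + p')"
    unfolding w_def g_def sum using pos by (simp add: field_simps)
  \<comment> \<open>\<open>a\<close> is a number in [0,1] minus \<open>l\<close>, so its modulus is
    at most 5; with \<open>g\<close> bounded by 1 this gives 2 * 5 + 2 * 1.\<close>
  have wb: "\<bar>w\<bar> \<le> 12"
  proof -
    have "0 \<le> (m + p / 2 - dn)\<^sup>2" "(m + p / 2 - dn)\<^sup>2 \<le> 1"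
      using small(5) by (auto simp: abs_square_le_1)
    then have "\<bar>a\<bar> \<le> 5" using a defects(4) small(1) by linarith
    moreover have "\<bar>g\<bar> \<le> 1" using defects(5) small(1) unfolding g_def by linarith
    ultimately show ?thesis unfolding w_def by linarith
  qed
  have p1: "p \<le> 1" "p' \<le> 1"
    using small(1-3) pos abs_square_le_1[of p] abs_square_le_1[of p'] by linarith+
  have dif: "\<bar>p - p'\<bar> \<le> 8 * E" using diff defects(1-3) by (auto simp: abs_le_iff)
  \<comment> \<open>Each step is at most \<open>p + p'\<close>, so the quotients in the remainder
    terms inherit the bound for \<open>w\<close>.\<close>
  have ph: "\<bar>a * p / h\<bar> \<le> \<bar>w\<bar>" "\<bar>a * p' / h\<bar> \<le> \<bar>w\<bar>"
  proof -
    have w: "\<bar>w\<bar> = \<bar>a\<bar> * (p + p') / h"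
    proof -
      have "w = a * (p + p') / h" using wh pos by (simp add: field_simps)
      then show ?thesis using pos by (simp add: abs_mult)
    qed
    show "\<bar>a * p / h\<bar> \<le> \<bar>w\<bar>" "\<bar>a * p' / h\<bar> \<le> \<bar>w\<bar>"
      unfolding w using pos by (auto simp: abs_mult intro!: divide_right_mono mult_left_mono)
  qed
  have A2b: "\<bar>A2\<bar> \<le> 16 * E"
  proof -
    have "\<bar>m * (p - p')\<bar> \<le> 1 * (8 * E)"
      unfolding abs_mult by (rule mult_mono) (use small dif in auto)
    moreover have "\<bar>m * dn\<bar> \<le> 1 * E"
      unfolding abs_mult by (rule mult_mono) (use small defects in auto)
    moreover have "(p / 2 - dn)\<^sup>2 \<le> p\<^sup>2"
      by (rule power_mono) (use small in auto)
    ultimately show ?thesis unfolding A2_def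
      using defects small(2) zero_le_power2[of "p / 2 - dn"] unfolding g_def[symmetric] by linarith
  qed
  have A2: "A2 = w / 2 + m * p' - (1 - m\<^sup>2)"
  proof -
    have "a = 1 - m\<^sup>2 - 2 * m * (p / 2 - dn) - (p / 2 - dn)\<^sup>2 - l"
      unfolding a by (simp add: power2_eq_square algebra_simps)
    then show ?thesis
      unfolding A2_def w_def by (simp add: algebra_simps add_divide_distrib)
  qed
  \<comment> \<open>The coefficient of \<open>f3\<close> contains
    \<open>a * (p^2 - p'^2) / (6 * h)\<close>; factoring the difference of squares yields
    \<open>w\<close> times the small number \<open>p - p'\<close>.\<close>
  define T3 where "T3 = w * (p - p') / 6 - m * p'\<^sup>2 / 3"
  define TR where "TR = (a * p / h) * p\<^sup>2 * R + (a * p' / h) * p'\<^sup>2 * R' + 2 * m * p'^3 * R'"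
  have id: "((1 - m\<^sup>2) * f2 - 2 * m * f1)
     - (a * (f1 + p / 2 * f2 + p\<^sup>2 / 6 * f3 + p^3 * R)
        - a' * (f1 - p' / 2 * f2 + p'\<^sup>2 / 6 * f3 - p'^3 * R')) / h = - (A2 * f2 + T3 * f3 + TR)"
  proof -
    have w: "w = a * (p + p') / h" using wh pos by (simp add: field_simps)
    show ?thesis unfolding A2 T3_def TR_def w a' using pos
      by (simp add: field_simps power2_eq_square power3_eq_cube)
  qed
  have tri: "\<bar>x + y + z\<bar> \<le> c1 + c2 + c3" if "\<bar>x\<bar> \<le> c1" "\<bar>y\<bar> \<le> c2" "\<bar>z\<bar> \<le> c3"
    for x y z c1 c2 c3 :: real using that by linarith
  \<comment> \<open>12 * 8 / 6 + 1 / 3, rounded up.\<close>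
  have "\<bar>T3\<bar> \<le> 17 * E"
  proof -
    have "\<bar>w * (p - p')\<bar> \<le> 12 * (8 * E)"
      unfolding abs_mult by (rule mult_mono) (use wb dif in auto)
    moreover have "\<bar>m * p'\<^sup>2\<bar> \<le> 1 * E"
      unfolding abs_mult by (rule mult_mono) (use small in auto)
    ultimately show ?thesis unfolding T3_def using E0 by linarith
  qed
  moreover have "\<bar>TR\<bar> \<le> 26 * E * B"
  proof -
    have cube: "0 \<le> p'^3" "p'^3 \<le> E"
    proof -
      have "p'^3 = p'\<^sup>2 * p'" by (simp add: power2_eq_square power3_eq_cube)
      also have "\<dots> \<le> p'\<^sup>2 * 1" by (rule mult_left_mono) (use p1 in auto)
      finally show "p'^3 \<le> E" using small by linarith
    qed (use pos in auto)
    have prod: "\<bar>x * y * z\<bar> \<le> c * E * B" if "\<bar>x\<bar> \<le> c" "0 \<le> y" "y \<le> E" "\<bar>z\<bar> \<le> B"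
      for x y z c :: real
      unfolding abs_mult by (intro mult_mono; use that E0 in auto)
    have "\<bar>TR\<bar> \<le> 12 * E * B + 12 * E * B + 2 * E * B"
      unfolding TR_def
    proof (intro tri prod)
      show "\<bar>a * p / h\<bar> \<le> 12" "\<bar>a * p' / h\<bar> \<le> 12" using ph wb by linarith+
      show "\<bar>2 * m\<bar> \<le> 2" using small by simp
    qed (use cube small f in auto)
    then show ?thesis by (simp add: algebra_simps)
  qed
  moreover have "\<bar>A2 * f2\<bar> \<le> 16 * E * B"
    unfolding abs_mult by (rule mult_mono) (use A2b f E0 in auto)
  moreover have "\<bar>T3 * f3\<bar> \<le> 17 * E * B" if "\<bar>T3\<bar> \<le> 17 * E"
    unfolding abs_mult by (rule mult_mono) (use that f E0 in auto)
  ultimately have "\<bar>A2 * f2 + T3 * f3 + TR\<bar> \<le> 16 * E * B + 17 * E * B + 26 * E * B"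
    by (intro tri)
  then show ?thesis unfolding id by simp
qed

text \<open>\<open>e\<close> is the distance from the first node to the end point -1 and
  \<open>p\<close> the adjacent step, so \<open>1 - m^2 = e * (2 - e)\<close> and
  \<open>- 2 * m = 2 * (1 - e)\<close> for \<open>m = e - 1\<close>. The \<open>f1\<close> terms
  cancel exactly, and the coefficient of \<open>f2\<close> is \<open>2 * e - p\<close> up to
  quadratic terms.\<close>

lemma boundary_consistency:
  fixes E B e p :: real
  assumes "E \<le> 1" "0 \<le> B" "0 \<le> p" "p \<le> 1" "p\<^sup>2 \<le> E" "0 \<le> e" "e\<^sup>2 \<le> E"
    "\<bar>2 * e - p\<bar> \<le> 6 * E" "\<bar>f2\<bar> \<le> B" "\<bar>f3\<bar> \<le> B" "\<bar>R\<bar> \<le> B"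
  shows "\<bar>e * (2 - e) * f2 + 2 * (1 - e) * f1
     - 2 * (1 - e) * (f1 + p / 2 * f2 + p\<^sup>2 / 6 * f3 + p^3 * R)\<bar> \<le> 20 * B * E"
proof -
  have E0: "0 \<le> E" using assms(5) zero_le_power2[of p] by linarith
  have e1: "e \<le> 1" using assms(1,6,7) abs_square_le_1[of e] by linarith
  define A where "A = (2 * e - p) - e\<^sup>2 + e * p"
  define Q where "Q = f3 / 6 + p * R"
  have id: "e * (2 - e) * f2 + 2 * (1 - e) * f1
     - 2 * (1 - e) * (f1 + p / 2 * f2 + p\<^sup>2 / 6 * f3 + p^3 * R) = A * f2 - 2 * ((1 - e) * p\<^sup>2 * Q)"
    unfolding A_def Q_def by (simp add: field_simps power2_eq_square power3_eq_cube)
  \<comment> \<open>Only squares of \<open>e\<close> and \<open>p\<close> are bounded by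
    \<open>E\<close>; this controls the mixed product \<open>e * p\<close>.\<close>
  have "0 \<le> (e - p)\<^sup>2" by simp
  then have "2 * (e * p) \<le> e\<^sup>2 + p\<^sup>2" by (simp add: power2_diff)
  moreover have "0 \<le> e * p" using assms by simp
  ultimately have "\<bar>A\<bar> \<le> 8 * E" unfolding A_def using assms(5,7,8) zero_le_power2[of e] by linarith
  then have "\<bar>A * f2\<bar> \<le> 8 * E * B"
    unfolding abs_mult by (rule mult_mono) (use assms E0 in auto)
  moreover have "\<bar>(1 - e) * p\<^sup>2 * Q\<bar> \<le> 1 * E * (2 * B)"
  proof -
    have "\<bar>p * R\<bar> \<le> 1 * B" unfolding abs_mult by (rule mult_mono) (use assms in auto)
    then have "\<bar>Q\<bar> \<le> 2 * B" unfolding Q_def using assms by linarith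
    then show ?thesis
      unfolding abs_mult by (intro mult_mono; use assms E0 e1 in auto)
  qed
  ultimately show ?thesis unfolding id using assms(2) E0 mult_nonneg_nonneg[of B E]
    by (simp add: algebra_simps)
qed

section \<open>Geometry and defects of a single mesh\<close>

text \<open>Collects the quantities that are to be of order 2. \<open>Mtilde\<close> is squared
  because it is of first order and enters the estimates quadratically.\<close>

definition mesh_error :: "(nat \<Rightarrow> nat \<Rightarrow> real) \<Rightarrow> (nat \<Rightarrow> nat \<Rightarrow> real) \<Rightarrow> nat \<Rightarrow> real" where
  "mesh_error mu nu N = (Mtilde mu N)\<^sup>2 + D mu nu N + D_star mu nu N
     + beta mu nu N + beta_star mu nu N + X mu nu N"

text \<open>With at least two nodes, the two boundary formulas of the scheme concern different
  nodes.\<close>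

locale mesh =
  fixes mu nu :: "nat \<Rightarrow> nat \<Rightarrow> real" and N :: nat
  assumes interl: "interlaced mu nu" and N2: "N \<ge> 2"
begin

abbreviation E :: real where "E \<equiv> mesh_error mu nu N"

lemma nu_ends: "nu N 0 = -1" "nu N N = 1"
  using interl N2 by (auto simp: interlaced_def)

lemma nu_mu: "1 \<le> n \<Longrightarrow> n \<le> N \<Longrightarrow> nu N (n - 1) < mu N n \<and> mu N n < nu N n"
  using interl N2 by (auto simp: interlaced_def)

lemma nu_less_Suc: "n < N \<Longrightarrow> nu N n < nu N (Suc n)"
  using nu_mu[of "Suc n"] by auto

lemma nu_bounds:
  assumes "n \<le> N"
  shows "nu N n \<in> {-1..1}"
proof -
  have "n \<le> N \<Longrightarrow> -1 \<le> nu N n"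
  proof (induction n)
    case (Suc n)
    then show ?case using nu_less_Suc[of n] by simp
  qed (simp add: nu_ends)
  moreover have "nu N n \<le> 1"
    using assms
  proof (induction n rule: inc_induct)
    case (step n)
    then show ?case using nu_less_Suc[of n] by simp
  qed (simp add: nu_ends)
  ultimately show ?thesis using assms by simp
qed

lemma mu_bounds:
  assumes "1 \<le> n" "n \<le> N"
  shows "mu N n \<in> {-1..1}"
proof -
  have "nu N (n - 1) \<in> {-1..1}" "nu N n \<in> {-1..1}"
    using assms by (auto intro!: nu_bounds simp del: atLeastAtMost_iff)
  then show ?thesis using nu_mu[OF assms] by auto
qed

lemma error_parts:
  "(Mtilde mu N)\<^sup>2 \<le> E" "D mu nu N \<le> E" "D_star mu nu N \<le> E"
  "beta mu nu N + beta_star mu nu N \<le> E" "X mu nu N \<le> E"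
proof -
  have "0 \<le> D mu nu N" "0 \<le> D_star mu nu N" "0 \<le> beta mu nu N" "0 \<le> beta_star mu nu N"
    "0 \<le> X mu nu N" "0 \<le> (Mtilde mu N)\<^sup>2"
    by (auto simp: D_def D_star_def beta_def beta_star_def X_def intro!: max_abs_nonneg)
  then show "(Mtilde mu N)\<^sup>2 \<le> E" "D mu nu N \<le> E" "D_star mu nu N \<le> E"
    "beta mu nu N + beta_star mu nu N \<le> E" "X mu nu N \<le> E"
    unfolding mesh_error_def by linarith+
qed

lemma Mtilde_ge:
  "mu N 1 + 1 \<le> Mtilde mu N" "1 - mu N N \<le> Mtilde mu N"
  "1 \<le> n \<Longrightarrow> n < N \<Longrightarrow> mu N (n + 1) - mu N n \<le> Mtilde mu N"
  unfolding Mtilde_def by (rule Max_ge; auto)+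

lemma square_le_E: "0 \<le> x \<Longrightarrow> x \<le> Mtilde mu N \<Longrightarrow> x\<^sup>2 \<le> E"
  using power_mono[of x "Mtilde mu N" 2] error_parts(1) by linarith

lemma mu_step:
  assumes "1 \<le> n" "n < N"
  shows "0 < mu N (n + 1) - mu N n" "(mu N (n + 1) - mu N n)\<^sup>2 \<le> E"
proof -
  show "0 < mu N (n + 1) - mu N n"
    using nu_mu[of n] nu_mu[of "n + 1"] assms by auto
  then show "(mu N (n + 1) - mu N n)\<^sup>2 \<le> E"
    using Mtilde_ge(3) assms by (intro square_le_E) auto
qed

lemma d_le: "1 \<le> n \<Longrightarrow> n < N \<Longrightarrow> \<bar>d mu nu N n\<bar> \<le> E"
  using max_abs_ge[of "{1..<N}" n "d mu nu N"] error_parts(2) by (auto simp: D_def)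

lemma d_star_le: "1 \<le> n \<Longrightarrow> n \<le> N \<Longrightarrow> \<bar>d_star mu nu N n\<bar> \<le> D_star mu nu N"
  using max_abs_ge[of "{1..N}" n "d_star mu nu N"] by (auto simp: D_star_def)

lemma lam_Suc:
  "lam mu nu N (Suc n) = lam mu nu N n - 2 * (nu N (Suc n) - nu N n) * d_star mu nu N (Suc n)"
  by (simp add: lam_def d_star_def diffusivity_def power2_eq_square field_simps)

lemma lam_le: "n \<le> N \<Longrightarrow> \<bar>lam mu nu N n\<bar> \<le> 4 * D_star mu nu N"
proof -
  \<comment> \<open>The induction needs a bound that grows with \<open>n\<close>: the gaps between
    half points telescope to \<open>nu N n + 1\<close>, which is at most 2.\<close>
  have *: "n \<le> N \<Longrightarrow> \<bar>lam mu nu N n\<bar> \<le> 2 * (nu N n + 1) * D_star mu nu N"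
  proof (induction n)
    case 0
    then show ?case by (simp add: lam_def diffusivity_def nu_ends)
  next
    case (Suc n)
    have "\<bar>(nu N (Suc n) - nu N n) * d_star mu nu N (Suc n)\<bar>
        \<le> (nu N (Suc n) - nu N n) * D_star mu nu N"
      unfolding abs_mult using nu_less_Suc[of n] d_star_le[of "Suc n"] Suc.prems
      by (intro mult_mono) auto
    then show ?case using Suc unfolding lam_Suc by (auto simp: algebra_simps)
  qed
  have "0 \<le> D_star mu nu N" by (simp add: D_star_def max_abs_nonneg)
  then show "\<bar>lam mu nu N n\<bar> \<le> 4 * D_star mu nu N" if "n \<le> N"
    using *[OF that] nu_bounds[OF that] mult_right_mono[of "2 * (nu N n + 1)" 4 "D_star mu nu N"]
    by auto
qed

lemma alpha_eq: "alpha mu nu N n = 1 - (nu N n)\<^sup>2 - lam mu nu N n"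
  by (simp add: lam_def diffusivity_def)

lemma alpha_pred:
  "1 \<le> n \<Longrightarrow> alpha mu nu N (n - 1) = alpha mu nu N n + 2 * mu N n * (nu N n - nu N (n - 1))"
  by (cases n) auto

text \<open>As \<open>alpha\<close> is \<open>diffusivity\<close> minus \<open>lam\<close>, the
  expression splits into one term of \<open>beta\<close> and one of \<open>beta_star\<close>. It
  provides the hypothesis on \<open>a * ((dn - dn') / h)\<close> in
  \<open>interior_consistency\<close>.\<close>

lemma alpha_d_diff_le:
  assumes "2 \<le> n" "n < N"
  shows "\<bar>alpha mu nu N n * ((d mu nu N n - d mu nu N (n - 1)) / (nu N n - nu N (n - 1)))\<bar> \<le> E"
proof -
  let ?b = "(d mu nu N (n - 1) - d mu nu N n) * diffusivity (nu N n) / (nu N n - nu N (n - 1))"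
  let ?bs = "(d mu nu N (n - 1) - d mu nu N n) * lam mu nu N n / (nu N n - nu N (n - 1))"
  have "\<bar>?b\<bar> \<le> beta mu nu N" "\<bar>?bs\<bar> \<le> beta_star mu nu N"
    unfolding beta_def beta_star_def by (rule max_abs_ge; use assms in auto)+
  moreover have "alpha mu nu N n * ((d mu nu N n - d mu nu N (n - 1)) / (nu N n - nu N (n - 1)))
      = ?bs - ?b"
    by (simp add: lam_def field_simps flip: diff_divide_distrib)
  ultimately show ?thesis using error_parts(4) by linarith
qed

text \<open>The right end is the left end of the mesh reflected at 0: hence the signs of \<open>f1\<close> and \<open>f3\<close>
  when \<open>boundary_consistency\<close> is applied there.\<close>

lemma error_le:
  fixes f f1 f2 f3 :: "real \<Rightarrow> real" and B :: real
  assumes E1: "E \<le> 1" and B: "0 \<le> B"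
    and bd: "\<And>x. x \<in> {-1..1} \<Longrightarrow> \<bar>f1 x\<bar> \<le> B \<and> \<bar>f2 x\<bar> \<le> B \<and> \<bar>f3 x\<bar> \<le> B"
    and FP: "\<And>x. x \<in> {-1..1} \<Longrightarrow> FP f x = (1 - x\<^sup>2) * f2 x - 2 * x * f1 x"
    and Taylor: "\<And>x y. x \<in> {-1..1} \<Longrightarrow> y \<in> {-1..1} \<Longrightarrow> \<exists>R. \<bar>R\<bar> \<le> B \<and>
       f y - f x = (y - x) * (f1 x + (y - x) / 2 * f2 x + (y - x)\<^sup>2 / 6 * f3 x + (y - x)^3 * R)"
    and n: "1 \<le> n" "n \<le> N"
  shows "\<bar>FP f (mu N n) - FP_typeII mu nu f N n\<bar> \<le> 59 * B * E"
proof -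
  have right: "\<exists>R. \<bar>R\<bar> \<le> B \<and> diff_quot mu f N n = f1 (mu N n) + p / 2 * f2 (mu N n)
      + p\<^sup>2 / 6 * f3 (mu N n) + p^3 * R"
    if "1 \<le> n" "n < N" and p: "p = mu N (n + 1) - mu N n" for n p
    using Taylor[of "mu N n" "mu N (n + 1)"] mu_bounds[of n] mu_bounds[of "n + 1"] that mu_step[of n]
    by (auto simp: diff_quot_def)
  \<comment> \<open>The expansion is about the right node of the interval, so the increment is
    \<open>- p\<close> and odd powers change sign.\<close>
  have left: "\<exists>R. \<bar>R\<bar> \<le> B \<and> diff_quot mu f N (n - 1) = f1 (mu N n) - p / 2 * f2 (mu N n)
      + p\<^sup>2 / 6 * f3 (mu N n) - p^3 * R"
    if n: "2 \<le> n" "n \<le> N" and p: "p = mu N n - mu N (n - 1)" for n p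
  proof -
    let ?q = "mu N (n - 1) - mu N n"
    obtain R where R: "\<bar>R\<bar> \<le> B" "f (mu N (n - 1)) - f (mu N n)
        = ?q * (f1 (mu N n) + ?q / 2 * f2 (mu N n) + ?q\<^sup>2 / 6 * f3 (mu N n) + ?q^3 * R)"
      using Taylor[OF mu_bounds[of n] mu_bounds[of "n - 1"]] n by fastforce
    have "?q = - p" using p by simp
    have "p > 0" using mu_step(1)[of "n - 1"] that by auto
    have "f (mu N n) - f (mu N (n - 1)) = p * (f1 (mu N n) - p / 2 * f2 (mu N n)
        + p\<^sup>2 / 6 * f3 (mu N n) - p^3 * R)"
      using R(2) unfolding \<open>?q = - p\<close> by (simp add: algebra_simps)
    then show ?thesis using R(1) that \<open>p > 0\<close> unfolding diff_quot_def
      by (intro exI[of _ R]) simp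
  qed
  have m: "mu N n \<in> {-1..1}" using mu_bounds n by simp
  note bd = bd[OF m] and FP = FP[OF m]
  have E0: "0 \<le> E" using error_parts(1) zero_le_power2[of "Mtilde mu N"] by linarith
  consider "n = 1" | "n = N" "n \<noteq> 1" | "2 \<le> n" "n < N" using n by linarith
  then show ?thesis
  proof cases
    case 1
    define p e where "p = mu N (1 + 1) - mu N 1" and "e = mu N 1 + 1"
    obtain R where R: "\<bar>R\<bar> \<le> B" "diff_quot mu f N 1 = f1 (mu N 1) + p / 2 * f2 (mu N 1)
        + p\<^sup>2 / 6 * f3 (mu N 1) + p^3 * R"
      using right[of 1 p] N2 p_def by auto
    have p: "0 < p" "p\<^sup>2 \<le> E" using mu_step[of 1] N2 by (auto simp: p_def)
    have e: "0 \<le> e" "e\<^sup>2 \<le> E" using square_le_E[OF _ Mtilde_ge(1)] m 1 by (auto simp: e_def)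
    \<comment> \<open>The half point \<open>nu N 1\<close> cancels between the two defects. This is
      the identity for differences of steps with a ghost node obtained by reflecting the first node
      at -1: its step is \<open>2 * e\<close> and its defect 0.\<close>
    have "2 * e - p = - 4 * d_star mu nu N 1 - 2 * d mu nu N 1"
      by (simp add: p_def e_def d_star_def d_def nu_ends field_simps)
    then have "\<bar>2 * e - p\<bar> \<le> 6 * E"
      using d_le[of 1] d_star_le[of 1] error_parts(3) N2 by auto
    then have "\<bar>e * (2 - e) * f2 (mu N 1) + 2 * (1 - e) * f1 (mu N 1)
     - 2 * (1 - e) * (f1 (mu N 1) + p / 2 * f2 (mu N 1) + p\<^sup>2 / 6 * f3 (mu N 1) + p^3 * R)\<bar> \<le> 20 * B * E"
      using E1 B p e R(1) bd 1 abs_square_le_1[of p] by (intro boundary_consistency) auto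
    \<comment> \<open>Since \<open>alpha\<close> starts at 0, its next value is
      \<open>- 2 * mu N 1\<close> times the cell length, and the division cancels exactly.\<close>
    moreover have "FP_typeII mu nu f N 1 = - 2 * mu N 1 * diff_quot mu f N 1"
      using nu_mu[of 1] N2 by (simp add: FP_typeII_def nu_ends)
    moreover have "e * (2 - e) = 1 - (mu N 1)\<^sup>2" "1 - e = - mu N 1"
      by (auto simp: e_def power2_eq_square algebra_simps)
    ultimately show ?thesis
      using FP mult_nonneg_nonneg[OF B E0] R(2) unfolding 1 by simp
  next
    case 2
    define p e where "p = mu N N - mu N (N - 1)" and "e = 1 - mu N N"
    define h where "h = 1 - nu N (N - 1)"
    obtain R where R: "\<bar>R\<bar> \<le> B" "diff_quot mu f N (N - 1) = f1 (mu N N) - p / 2 * f2 (mu N N)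
        + p\<^sup>2 / 6 * f3 (mu N N) - p^3 * R"
      using left[of N p] N2 p_def by auto
    have p: "0 < p" "p\<^sup>2 \<le> E" using mu_step[of "N - 1"] N2 by (auto simp: p_def)
    have e: "0 \<le> e" "e\<^sup>2 \<le> E" using square_le_E[OF _ Mtilde_ge(2)] m 2 by (auto simp: e_def)
    have h: "h > 0" using nu_less_Suc[of "N - 1"] nu_ends N2 by (auto simp: h_def)
    have p1: "p \<le> 1" using p E1 abs_square_le_1[of p] by auto
    have "2 * e - p = 4 * d_star mu nu N N + 2 * d mu nu N (N - 1)"
      using N2 by (simp add: p_def e_def d_star_def d_def nu_ends field_simps)
    then have "\<bar>2 * e - p\<bar> \<le> 6 * E"
      using d_le[of "N - 1"] d_star_le[of N] error_parts(3) N2 by force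
    then have b: "\<bar>e * (2 - e) * f2 (mu N N) + 2 * (1 - e) * - f1 (mu N N)
     - 2 * (1 - e) * (- f1 (mu N N) + p / 2 * f2 (mu N N) + p\<^sup>2 / 6 * (- f3 (mu N N)) + p^3 * R)\<bar>
       \<le> 20 * B * E"
      using E1 B p p1 e R(1) bd 2 by (intro boundary_consistency) auto
    have e1: "- f1 (mu N N) + p / 2 * f2 (mu N N) + p\<^sup>2 / 6 * (- f3 (mu N N)) + p^3 * R
        = - diff_quot mu f N (N - 1)" using R(2) by simp
    have e2: "e * (2 - e) = 1 - (mu N N)\<^sup>2" "1 - e = mu N N"
      by (auto simp: e_def power2_eq_square algebra_simps)
    \<comment> \<open>Unlike at the left end, the outermost \<open>alpha\<close> need not vanish. It
      leaves an extra term, which \<open>X\<close> controls.\<close>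
    have S: "FP_typeII mu nu f N N
        = - 2 * mu N N * diff_quot mu f N (N - 1) - alpha mu nu N N / h * diff_quot mu f N (N - 1)"
    proof -
      have "alpha mu nu N (N - 1) = alpha mu nu N N + 2 * mu N N * h"
        using alpha_pred[of N] N2 by (simp add: h_def nu_ends)
      moreover have "FP_typeII mu nu f N N = - alpha mu nu N (N - 1) * diff_quot mu f N (N - 1) / h"
        using N2 by (simp add: FP_typeII_def h_def)
      ultimately show ?thesis using h by (simp add: field_simps)
    qed
    have v: "\<bar>alpha mu nu N N / h * diff_quot mu f N (N - 1)\<bar> \<le> E * (4 * B)"
    proof -
      have "\<bar>alpha mu nu N N / h\<bar> \<le> E" using error_parts(5) by (simp add: X_def h_def)
      \<comment> \<open>Each of the four Taylor terms is at most \<open>B\<close>, because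
        \<open>p\<close> is at most 1.\<close>
      moreover have "\<bar>diff_quot mu f N (N - 1)\<bar> \<le> 4 * B"
      proof -
        have "\<bar>p / 2 * f2 (mu N N)\<bar> \<le> 1 * B" "\<bar>p\<^sup>2 / 6 * f3 (mu N N)\<bar> \<le> 1 * B" "\<bar>p^3 * R\<bar> \<le> 1 * B"
          unfolding abs_mult
          by (intro mult_mono; use p p1 bd 2 R(1) E1 power_le_one[of p 3] in auto)+
        then show ?thesis unfolding R(2) using bd 2 by auto
      qed
      ultimately show ?thesis unfolding abs_mult using E0 by (intro mult_mono) auto
    qed
    have "FP f (mu N N) - FP_typeII mu nu f N N
        = ((1 - (mu N N)\<^sup>2) * f2 (mu N N) + 2 * mu N N * - f1 (mu N N)
           - 2 * mu N N * - diff_quot mu f N (N - 1))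
          + alpha mu nu N N / h * diff_quot mu f N (N - 1)"
      using FP unfolding S 2 by simp
    also have "\<bar>\<dots>\<bar> \<le> 20 * B * E + E * (4 * B)"
      by (rule order_trans[OF abs_triangle_ineq add_mono[OF b[unfolded e1 e2] v]])
    also have "\<dots> \<le> 59 * B * E"
      using mult_nonneg_nonneg[OF B E0] by (simp add: algebra_simps)
    finally show ?thesis unfolding 2 .
  next
    case 3
    define p p' h where "p = mu N (n + 1) - mu N n" and "p' = mu N n - mu N (n - 1)"
      and "h = nu N n - nu N (n - 1)"
    define a a' dn dn' ds l where "a = alpha mu nu N n" and "a' = alpha mu nu N (n - 1)"
      and "dn = d mu nu N n" and "dn' = d mu nu N (n - 1)"
      and "ds = d_star mu nu N n" and "l = lam mu nu N n"
    obtain R where R: "\<bar>R\<bar> \<le> B" "diff_quot mu f N n = f1 (mu N n) + p / 2 * f2 (mu N n)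
        + p\<^sup>2 / 6 * f3 (mu N n) + p^3 * R"
      using right[of n p] 3 p_def by auto
    obtain R' where R': "\<bar>R'\<bar> \<le> B" "diff_quot mu f N (n - 1) = f1 (mu N n) - p' / 2 * f2 (mu N n)
        + p'\<^sup>2 / 6 * f3 (mu N n) - p'^3 * R'"
      using left[of n p'] 3 p'_def by auto
    have nu: "mu N n + p / 2 - dn = nu N n"
      by (simp add: p_def dn_def d_def field_simps)
    \<comment> \<open>The defect \<open>d\<close> at index \<open>n - 1\<close> refers to the node
      with index \<open>n - 1 + 1\<close>.\<close>
    have n': "n - 1 + 1 = n" using 3 by simp
    have "\<bar>((1 - (mu N n)\<^sup>2) * f2 (mu N n) - 2 * mu N n * f1 (mu N n))
     - (a * (f1 (mu N n) + p / 2 * f2 (mu N n) + p\<^sup>2 / 6 * f3 (mu N n) + p^3 * R)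
        - a' * (f1 (mu N n) - p' / 2 * f2 (mu N n) + p'\<^sup>2 / 6 * f3 (mu N n) - p'^3 * R')) / h\<bar>
      \<le> 59 * B * E"
    proof (rule interior_consistency[where dn = dn and dn' = dn' and ds = ds and l = l])
      show "h > 0" using nu_less_Suc[of "n - 1"] 3 by (simp add: h_def)
      show "p > 0" "p\<^sup>2 \<le> E" using mu_step[of n] 3 by (auto simp: p_def)
      show "p' > 0" "p'\<^sup>2 \<le> E" using mu_step[of "n - 1"] 3 by (auto simp: p'_def)
      show "0 \<le> B" "E \<le> 1" "\<bar>R\<bar> \<le> B" "\<bar>R'\<bar> \<le> B" by fact+
      show "\<bar>mu N n\<bar> \<le> 1" using m by auto
      show "\<bar>mu N n + p / 2 - dn\<bar> \<le> 1" unfolding nu using nu_bounds[of n] n by auto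
      show "0 \<le> p / 2 - dn" using nu nu_mu[of n] n by linarith
      show "p / 2 - dn \<le> p" using nu nu_mu[of "n + 1"] 3 by (simp add: p_def)
      show "\<bar>dn\<bar> \<le> E" "\<bar>dn'\<bar> \<le> E" using d_le[of n] d_le[of "n - 1"] 3 by (auto simp: dn_def dn'_def)
      show "\<bar>ds\<bar> \<le> E" using d_star_le[of n] error_parts(3) n by (auto simp: ds_def)
      show "\<bar>l\<bar> \<le> 4 * E" using lam_le[of n] error_parts(3) n by (auto simp: l_def)
      show "\<bar>a * ((dn - dn') / h)\<bar> \<le> E"
        using alpha_d_diff_le[OF 3] by (simp add: a_def dn_def dn'_def h_def)
      show "p + p' = 2 * (h + (dn - dn'))" "p - p' = 4 * ds + 2 * (dn + dn')"
        using n' by (simp_all add: p_def p'_def h_def dn_def dn'_def ds_def d_def d_star_def field_simps)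
      show "a' = a + 2 * mu N n * h" using alpha_pred[of n] n by (simp add: a_def a'_def h_def)
      show "a = 1 - (mu N n + p / 2 - dn)\<^sup>2 - l"
        unfolding nu by (simp add: a_def l_def alpha_eq)
      show "\<bar>f2 (mu N n)\<bar> \<le> B" "\<bar>f3 (mu N n)\<bar> \<le> B" using bd by auto
    qed
    moreover have "FP_typeII mu nu f N n = (a * diff_quot mu f N n - a' * diff_quot mu f N (n - 1)) / h"
      using 3 by (simp add: FP_typeII_def a_def a'_def h_def)
    ultimately show ?thesis unfolding FP R(2) R'(2) by simp
  qed
qed

end

section \<open>Asymptotics as N tends to infinity\<close>

lemma bigo_powr_mono:
  fixes g :: "nat \<Rightarrow> real"
  assumes "g \<in> O(\<lambda>N. real N powr (- p))" "p' \<le> p"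
  shows "g \<in> O(\<lambda>N. real N powr (- p'))"
proof -
  have "(\<lambda>N. real N powr (- p)) \<in> O(\<lambda>N. real N powr (- p'))"
    by (rule landau_o.big_mono, rule eventually_mono[OF eventually_ge_at_top[of 1]])
      (use assms(2) in \<open>auto intro!: powr_mono\<close>)
  then show ?thesis by (rule landau_o.big_trans[OF assms(1)])
qed

lemma bigo_eventually_zero: "(\<And>N. 1 \<le> N \<Longrightarrow> g N = 0) \<Longrightarrow> g \<in> O(h)"
  for g h :: "nat \<Rightarrow> real"
  by (rule landau_o.big_mono, rule eventually_mono[OF eventually_ge_at_top[of 1]]) auto

text \<open>\<open>error_le\<close> applies once \<open>N\<close> is at least 2 and
  \<open>mesh_error\<close> is at most 1, which holds eventually. Its factor \<open>59 * B\<close>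
  depends on \<open>f\<close> alone, so the nodewise bound is uniform in the node and in
  \<open>N\<close>.\<close>

lemma typeII_converges_2:
  assumes interl: "interlaced mu nu" and M: "Mtilde mu \<in> O(\<lambda>N. real N powr (- 1))"
    and O2: "D_star mu nu \<in> O(\<lambda>N. real N powr (- 2))" "D mu nu \<in> O(\<lambda>N. real N powr (- 2))"
      "beta mu nu \<in> O(\<lambda>N. real N powr (- 2))" "beta_star mu nu \<in> O(\<lambda>N. real N powr (- 2))"
      "X mu nu \<in> O(\<lambda>N. real N powr (- 2))"
    and f: "Ck_on 4 {-1..1} f"
  shows "typeII_converges 2 mu nu f"
proof -
  have powr_eq: "real N powr (- 1) * real N powr (- 1) = real N powr (- 2)" for N
    by (subst powr_add[symmetric]) simp
  have "(\<lambda>N. (Mtilde mu N)\<^sup>2) \<in> O(\<lambda>N. real N powr (- 2))"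
    using landau_o.big.mult[OF M M] unfolding power2_eq_square powr_eq .
  then have E: "mesh_error mu nu \<in> O(\<lambda>N. real N powr (- 2))"
    unfolding mesh_error_def using O2 by (intro sum_in_bigo) auto
  \<comment> \<open>A quantity of order 2 tends to 0 and so is eventually at most 1, the smallness
    required by \<open>error_le\<close>.\<close>
  have "((\<lambda>N. real N powr (- 2)) \<longlongrightarrow> 0) sequentially"
    by (rule tendsto_neg_powr) (auto simp: filterlim_real_sequentially)
  then have "(\<lambda>N. real N powr (- 2)) \<in> o(\<lambda>_. 1)"
    by (intro smalloI_tendsto) auto
  from landau_o.smallD[OF landau_o.big_small_trans[OF E this], of 1]
  have small: "eventually (\<lambda>N. \<bar>mesh_error mu nu N\<bar> \<le> 1) sequentially" by simp
  obtain f1 f2 f3 B where B: "0 \<le> B"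
    "\<And>x. x \<in> {-1..1} \<Longrightarrow> \<bar>f1 x\<bar> \<le> B \<and> \<bar>f2 x\<bar> \<le> B \<and> \<bar>f3 x\<bar> \<le> B"
    "\<And>x. x \<in> {-1..1} \<Longrightarrow> FP f x = (1 - x\<^sup>2) * f2 x - 2 * x * f1 x"
    "\<And>x y. x \<in> {-1..1} \<Longrightarrow> y \<in> {-1..1} \<Longrightarrow> \<exists>R. \<bar>R\<bar> \<le> B \<and>
       f y - f x = (y - x) * (f1 x + (y - x) / 2 * f2 x + (y - x)\<^sup>2 / 6 * f3 x + (y - x)^3 * R)"
    by (rule Ck_on_4_expansion[OF f]) (rule that)
  have "eventually (\<lambda>N. norm (max_abs {1..N} (\<lambda>n. FP f (mu N n) - FP_typeII mu nu f N n))
      \<le> 59 * B * norm (mesh_error mu nu N)) sequentially"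
    using small eventually_ge_at_top[of 2]
  proof eventually_elim
    case (elim N)
    interpret mesh mu nu N by unfold_locales (use interl elim in auto)
    have "max_abs {1..N} (\<lambda>n. FP f (mu N n) - FP_typeII mu nu f N n) \<le> 59 * B * \<bar>E\<bar>"
    proof (rule max_abs_le)
      show "\<bar>FP f (mu N n) - FP_typeII mu nu f N n\<bar> \<le> 59 * B * \<bar>E\<bar>" if "n \<in> {1..N}" for n
      proof -
        have "\<bar>FP f (mu N n) - FP_typeII mu nu f N n\<bar> \<le> 59 * B * E"
          by (rule error_le[of B f1 f2 f3 f]) (use B elim that in auto)
        also have "\<dots> \<le> 59 * B * \<bar>E\<bar>" using B(1) by (intro mult_left_mono) auto
        finally show ?thesis .
      qed
    qed (use B(1) in auto)
    then show ?case by (simp add: max_abs_nonneg)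
  qed
  then have "(\<lambda>N. max_abs {1..N} (\<lambda>n. FP f (mu N n) - FP_typeII mu nu f N n)) \<in> O(mesh_error mu nu)"
    by (rule bigoI)
  then show ?thesis
    unfolding typeII_converges_def by (rule landau_o.big_trans[OF _ E])
qed

text \<open>Each term is at most \<open>2 * D\<close> times \<open>4 * D_star\<close> (from
  \<open>lam_le\<close>) divided by \<open>m_star\<close>, whence the factor 8. The resulting order
  is \<open>r + q - s\<close>, which is at least \<open>q\<close> when
  \<open>s \<le> r\<close>.\<close>

lemma beta_star_bigo:
  assumes interl: "interlaced mu nu"
    and Ds: "D_star mu nu \<in> O(\<lambda>N. real N powr (- q))"
    and D: "D mu nu \<in> O(\<lambda>N. real N powr (- r))"
    and ms: "(\<lambda>N. 1 / m_star nu N) \<in> O(\<lambda>N. real N powr s)" and sr: "s \<le> r"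
  shows "beta_star mu nu \<in> O(\<lambda>N. real N powr (- q))"
proof -
  have "eventually (\<lambda>N. norm (beta_star mu nu N)
      \<le> 8 * norm (D mu nu N * D_star mu nu N * (1 / m_star nu N))) sequentially"
    using eventually_ge_at_top[of 2]
  proof eventually_elim
    case (elim N)
    interpret mesh mu nu N by unfold_locales (use interl elim in auto)
    have D0: "0 \<le> D mu nu N" "0 \<le> D_star mu nu N"
      by (simp_all add: D_def D_star_def max_abs_nonneg)
    have "0 < nu N n - nu N (n - 1)" if "n \<in> {1..N}" for n
      using nu_mu[of n] that by auto
    then have ms: "0 < m_star nu N" "\<And>n. n \<in> {1..N} \<Longrightarrow> m_star nu N \<le> nu N n - nu N (n - 1)"
      unfolding m_star_def using elim by (subst Min_gr_iff; auto) (auto intro!: Min_le)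
    have "beta_star mu nu N \<le> 8 * (D mu nu N * D_star mu nu N * (1 / m_star nu N))"
      unfolding beta_star_def
    proof (rule max_abs_le)
      show "\<bar>(d mu nu N (n - 1) - d mu nu N n) * lam mu nu N n / (nu N n - nu N (n - 1))\<bar>
          \<le> 8 * (D mu nu N * D_star mu nu N * (1 / m_star nu N))" if n: "n \<in> {2..<N}" for n
      proof -
        have "\<bar>d mu nu N (n - 1)\<bar> \<le> D mu nu N" "\<bar>d mu nu N n\<bar> \<le> D mu nu N"
          unfolding D_def using n by (auto intro!: max_abs_ge)
        then have dd: "\<bar>d mu nu N (n - 1) - d mu nu N n\<bar> \<le> 2 * D mu nu N" by linarith
        have "m_star nu N \<le> nu N n - nu N (n - 1)" using ms(2) n by auto
        then have "\<bar>(d mu nu N (n - 1) - d mu nu N n) * lam mu nu N n / (nu N n - nu N (n - 1))\<bar>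
          \<le> (2 * D mu nu N) * (4 * D_star mu nu N) / m_star nu N"
          unfolding abs_mult abs_divide using dd lam_le[of n] n D0 ms(1)
          by (intro frac_le mult_mono) auto
        then show ?thesis by simp
      qed
    qed (use D0 ms(1) in auto)
    then show ?case
      using D0 ms(1) by (simp add: beta_star_def max_abs_nonneg)
  qed
  then have "beta_star mu nu \<in> O(\<lambda>N. D mu nu N * D_star mu nu N * (1 / m_star nu N))"
    by (rule bigoI)
  also have "(\<lambda>N. D mu nu N * D_star mu nu N * (1 / m_star nu N))
      \<in> O(\<lambda>N. real N powr (- r) * real N powr (- q) * real N powr s)"
    by (intro landau_o.big.mult D Ds ms)
  also have "(\<lambda>N. real N powr (- r) * real N powr (- q) * real N powr s)
      = (\<lambda>N. real N powr (- (r + q - s)))"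
    by (simp flip: powr_add add: algebra_simps)
  finally show ?thesis by (rule bigo_powr_mono) (use sr in auto)
qed

section \<open>Reduction of each set of hypotheses to bounds of order 2\<close>

theorem theorem4:
  fixes mu nu :: "nat \<Rightarrow> nat \<Rightarrow> real" and q r s t u v :: real
  shows "(interlaced mu nu \<and>
      Mtilde mu \<in> O(\<lambda>N. real N powr (- 1)) \<and>
      q \<ge> 2 \<and> D_star mu nu \<in> O(\<lambda>N. real N powr (- q)) \<and>
      r \<ge> 2 \<and> D mu nu \<in> O(\<lambda>N. real N powr (- r)) \<and>
      1 \<le> s \<and> s \<le> 4 * min q r - 2 \<and> (\<lambda>N. 1 / m_star nu N) \<in> O(\<lambda>N. real N powr s) \<and>
      t \<ge> 2 \<and> beta mu nu \<in> O(\<lambda>N. real N powr (- t)) \<and>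
      u \<ge> 2 \<and> beta_star mu nu \<in> O(\<lambda>N. real N powr (- u)) \<and>
      v \<ge> 2 \<and> X mu nu \<in> O(\<lambda>N. real N powr (- v))
      \<longrightarrow> (\<forall>f. Ck_on 5 {-1..1} f \<longrightarrow> typeII_converges 2 mu nu f)) \<and>
    ((\<forall>N\<ge>1. D mu nu N = 0 \<and> D_star mu nu N = 0) \<and>
      interlaced mu nu \<and>
      Mtilde mu \<in> O(\<lambda>N. real N powr (- 1)) \<and>
      v \<ge> 2 \<and> X mu nu \<in> O(\<lambda>N. real N powr (- v))
      \<longrightarrow> (\<forall>f. Ck_on 5 {-1..1} f \<longrightarrow> typeII_converges 2 mu nu f)) \<and>
    ((\<forall>N\<ge>1. \<forall>n\<in>{1..<N}. d mu nu N n = d mu nu N 1) \<and>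
      interlaced mu nu \<and>
      Mtilde mu \<in> O(\<lambda>N. real N powr (- 1)) \<and>
      q \<ge> 2 \<and> D_star mu nu \<in> O(\<lambda>N. real N powr (- q)) \<and>
      r \<ge> 2 \<and> D mu nu \<in> O(\<lambda>N. real N powr (- r)) \<and>
      1 \<le> s \<and> s \<le> 4 * min q r - 2 \<and> (\<lambda>N. 1 / m_star nu N) \<in> O(\<lambda>N. real N powr s) \<and>
      v \<ge> 2 \<and> X mu nu \<in> O(\<lambda>N. real N powr (- v))
      \<longrightarrow> (\<forall>f. Ck_on 5 {-1..1} f \<longrightarrow> typeII_converges 2 mu nu f)) \<and>
    ((\<forall>N\<ge>1. Lam mu nu N = 0) \<and>
      interlaced mu nu \<and>
      Mtilde mu \<in> O(\<lambda>N. real N powr (- 1)) \<and>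
      q \<ge> 2 \<and> D_star mu nu \<in> O(\<lambda>N. real N powr (- q)) \<and>
      r \<ge> 2 \<and> D mu nu \<in> O(\<lambda>N. real N powr (- r)) \<and>
      1 \<le> s \<and> s \<le> 4 * min q r - 2 \<and> (\<lambda>N. 1 / m_star nu N) \<in> O(\<lambda>N. real N powr s) \<and>
      t \<ge> 2 \<and> beta mu nu \<in> O(\<lambda>N. real N powr (- t))
      \<longrightarrow> (\<forall>f. Ck_on 5 {-1..1} f \<longrightarrow> typeII_converges 2 mu nu f)) \<and>
    (s \<le> r \<and>
      interlaced mu nu \<and>
      Mtilde mu \<in> O(\<lambda>N. real N powr (- 1)) \<and>
      q \<ge> 2 \<and> D_star mu nu \<in> O(\<lambda>N. real N powr (- q)) \<and>
      r \<ge> 2 \<and> D mu nu \<in> O(\<lambda>N. real N powr (- r)) \<and>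
      1 \<le> s \<and> s \<le> 4 * min q r - 2 \<and> (\<lambda>N. 1 / m_star nu N) \<in> O(\<lambda>N. real N powr s) \<and>
      t \<ge> 2 \<and> beta mu nu \<in> O(\<lambda>N. real N powr (- t)) \<and>
      v \<ge> 2 \<and> X mu nu \<in> O(\<lambda>N. real N powr (- v))
      \<longrightarrow> (\<exists>u\<ge>2. beta_star mu nu \<in> O(\<lambda>N. real N powr (- u))) \<and>
        (\<forall>f. Ck_on 5 {-1..1} f \<longrightarrow> typeII_converges 2 mu nu f))"
  (is "(?main \<longrightarrow> ?conv) \<and> (?i \<longrightarrow> ?conv) \<and> (?ii \<longrightarrow> ?conv) \<and> (?iii \<longrightarrow> ?conv) \<and> (?last \<longrightarrow> ?auto \<and> ?conv)")
proof (intro conjI impI)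
  note weaken = bigo_powr_mono[where p' = 2]
  have conv: "\<forall>f. Ck_on 5 {-1..1} f \<longrightarrow> typeII_converges 2 mu nu f"
    if "interlaced mu nu" "Mtilde mu \<in> O(\<lambda>N. real N powr (- 1))"
      "D_star mu nu \<in> O(\<lambda>N. real N powr (- 2))" "D mu nu \<in> O(\<lambda>N. real N powr (- 2))"
      "beta mu nu \<in> O(\<lambda>N. real N powr (- 2))" "beta_star mu nu \<in> O(\<lambda>N. real N powr (- 2))"
      "X mu nu \<in> O(\<lambda>N. real N powr (- 2))"
    using typeII_converges_2[OF that] Ck_on_mono[of 5 _ _ 4] by auto
  \<comment> \<open>Equal defects annihilate the differences in the numerators of both
    \<open>beta\<close> and \<open>beta_star\<close>; this serves cases (i) and (ii).\<close>
  have beta_0: "beta mu nu N = 0 \<and> beta_star mu nu N = 0"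
    if const: "\<And>n. n \<in> {1..<N} \<Longrightarrow> d mu nu N n = d mu nu N 1" for N
  proof -
    have "d mu nu N (n - 1) - d mu nu N n = 0" if n: "n \<in> {2..<N}" for n
    proof -
      have "d mu nu N (n - 1) = d mu nu N 1" "d mu nu N n = d mu nu N 1"
        by (rule const; use n in auto)+
      then show ?thesis by simp
    qed
    then show ?thesis by (auto simp: beta_def beta_star_def max_abs_def)
  qed
  {
    assume ?main
    then show "?conv"
      using weaken[of "D_star mu nu" q] weaken[of "D mu nu" r] weaken[of "beta mu nu" t]
        weaken[of "beta_star mu nu" u] weaken[of "X mu nu" v]
      by (intro conv) blast+
  next
    assume i: ?i
    then have "\<forall>N\<ge>1. D mu nu N = 0" by blast
    then have "d mu nu N n = 0" if "n \<in> {1..<N}" for N n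
      using max_abs_ge[of "{1..<N}" n "d mu nu N"] that by (auto simp: D_def)
    then have "beta mu nu N = 0 \<and> beta_star mu nu N = 0" for N
      by (intro beta_0) auto
    with i show "?conv"
      using weaken[of "X mu nu" v] by (intro conv) (blast intro: bigo_eventually_zero)+
  next
    assume ii: ?ii
    then have const: "\<forall>N\<ge>1. \<forall>n\<in>{1..<N}. d mu nu N n = d mu nu N 1" by blast
    have "beta mu nu N = 0 \<and> beta_star mu nu N = 0" if "1 \<le> N" for N
      by (intro beta_0) (use const that in blast)
    with ii show "?conv"
      using weaken[of "D_star mu nu" q] weaken[of "D mu nu" r] weaken[of "X mu nu" v]
      by (intro conv) (blast intro: bigo_eventually_zero)+
  next
    assume iii: ?iii
    then have inter: "interlaced mu nu" and "\<forall>N\<ge>1. Lam mu nu N = 0" by blast+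
    then have lam0: "lam mu nu N n = 0" if "1 \<le> N" "n \<le> N" for N n
      using max_abs_ge[of "{0..N}" n "lam mu nu N"] that by (auto simp: Lam_def)
    then have "beta_star mu nu N = 0" if "1 \<le> N" for N
      using that by (auto simp: beta_star_def max_abs_def)
    \<comment> \<open>At the right end point \<open>diffusivity\<close> vanishes, so the last
      \<open>alpha\<close> is \<open>- lam\<close>, which is 0 here; thus condition (8) holds in
      case (iii).\<close>
    moreover have "X mu nu N = 0" if "1 \<le> N" for N
      using lam0[of N N] inter that by (auto simp: X_def lam_def diffusivity_def interlaced_def)
    ultimately show "?conv"
      using iii weaken[of "D_star mu nu" q] weaken[of "D mu nu" r] weaken[of "beta mu nu" t]
      by (intro conv) (blast intro: bigo_eventually_zero)+
  next
    assume last: ?last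
    \<comment> \<open>The exponent \<open>q\<close> is the witness for \<open>u\<close>.\<close>
    then have bs: "beta_star mu nu \<in> O(\<lambda>N. real N powr (- q))"
      by (intro beta_star_bigo[of mu nu q r s]) blast+
    with last show ?auto by blast
    from last bs show "?conv"
      using weaken[of "D_star mu nu" q] weaken[of "D mu nu" r] weaken[of "beta mu nu" t]
        weaken[of "beta_star mu nu" q] weaken[of "X mu nu" v]
      by (intro conv) blast+
  }
qed

end
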